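(* Let $Q$ be the true $m\times k$ $Q$-matrix and let $c,g\in[0,1]^m$ be known. Assume: (C1) $Q$ is complete; (C2) the $T$-matrices are saturated; (C3) $\mathbf A_1,\ldots,\mathbf A_N$ are i.i.d. random vectors in $\{0,1\}^k$ with $P(\mathbf A_r=\mathbf A)=p^*_{\mathbf A}$ for all $\mathbf A\in\{0,1\}^k$; (C4) $p^*_{\mathbf A}>0$ for every $\mathbf A\in\{0,1\}^k$ (including $\mathbf A=\mathbf 0$); (C5) each attribute is required by at least two items, i.e. every column of $Q$ contains at least two entries equal to $1$. Suppose that for subject $r$ the responses are generated independently with $$P(R_r^i=1\mid\xi_r^i)=c_i^{\xi_r^i}g_i^{1-\xi_r^i},\qquad \xi_r^i=\prod_{j=1}^k(A_r^j)^{Q_{ij}},\quad i=1,\ldots,m.$$ Let $\hat Q(c,g)=\arg\inf_{Q'}S_{c,g}(Q')$, the infimum being over all candidate $m\times k$ $Q$-matrices $Q'$. If $c_i\neq g_i$ for all $i$ and $T_{c-g}(Q)\mathbf p^*$ does not have zero elements, where $\mathbf p^*=(p^*_{\mathbf A}:\mathbf A\in\{0,1\}^k\setminus\{\mathbf 0\})$, then $$\lim_{N\to\infty}P(\hat Q(c,g)\sim Q)=1 .$$ Furthermore, let $$\tilde{\mathbf p}(c,g)=\arg\inf_{\mathbf p}\,|T_{c,g}(\hat Q(c,g))\mathbf p+p_{\mathbf 0}\mathbf g-\alpha|^2$$ subject to the constraint $\sum_{\mathbf A\in\{0,1\}^k}p_{\mathbf A}=1$. Then, with an appropriate rearrangement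 of the columns of $\hat Q(c,g)$ (one for which $\hat Q(c,g)=Q$ whenever $\hat Q(c,g)\sim Q$), for any $\varepsilon>0$, $$\lim_{N\to\infty}P(|\tilde{\mathbf p}(c,g)-\mathbf p^*|\le\varepsilon)=1.$$
   Context: There are $m$ items and $k$ attributes, with $m,k$ known. A $Q$-matrix is an $m\times k$ binary matrix with no zero row (every item requires at least one attribute); $Q_{ij}=1$ means that item $i$ requires attribute $j$. Subject $r$ ($r=1,\ldots,N$) has an unobserved attribute vector $\mathbf A_r\in\{0,1\}^k$ and an observed response vector $\mathbf R_r=(R_r^1,\ldots,R_r^m)^\top\in\{0,1\}^m$; given $(\xi_r^1,\ldots,\xi_r^m)$ the responses $R_r^1,\ldots,R_r^m$ are jointly independent, and different subjects are independent. $1-c_i$ is the slipping probability and $g_i$ the guessing probability of item $i$. Convention: $0^0=1$. For a $Q$-matrix $Q'$ and $\mathbf A\in\{0,1\}^k$ put $\xi^i_{Q'}(\mathbf A)=\prod_{j=1}^k(A^j)^{Q'_{ij}}$. The columns of $T_{c,g}(Q')$ are indexed by $\mathbf A\in\{0,1\}^k\setminus\{\mathbf 0\}$, and its rows by combinations $I_{i_1}\wedge\cdots\wedge I_{i_l}$ of distinct items ($I_i$ stands for a positive response to item $i$); the corresponding entry is $\prod_{h=1}^l\bigl(g_{i_h}+(c_{i_h}-g_{i_h})\xi^{i_h}_{Q'}(\mathbf A)\bigr)$. Saturated means that all combinations, $l=1,\ldots,m$, are included ($2^m-1$ rows). For $d\in\mathbb R^m$, $T_d(Q')$ is the matrix with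 entries $\prod_{h=1}^l d_{i_h}\xi^{i_h}_{Q'}(\mathbf A)$ (i.e. $T_{d,g}$ with $g=0$), and $c-g=(c_1-g_1,\ldots,c_m-g_m)$. $\mathbf g$ is the column vector indexed like the rows of $T_{c,g}$, with entry $g_{i_1}\cdots g_{i_l}$ for $I_{i_1}\wedge\cdots\wedge I_{i_l}$; $\alpha$ is the column vector indexed the same way with entry $\frac1N\#\{r:R_r^{i_1}=\cdots=R_r^{i_l}=1\}$. $S_{c,g}(Q')=\inf|T_{c,g}(Q')\mathbf p+p_{\mathbf 0}\mathbf g-\alpha|$ ($|\cdot|$ the Euclidean norm), the infimum being over $\mathbf p=(p_{\mathbf A}:\mathbf A\neq\mathbf 0)$ and $p_{\mathbf 0}$ subject to $p_{\mathbf A}\in[0,1]$ for all $\mathbf A\in\{0,1\}^k$ and $\sum_{\mathbf A\in\{0,1\}^k}p_{\mathbf A}=1$. In the definition of $\tilde{\mathbf p}(c,g)$ the $p_{\mathbf A}$ are likewise probabilities in $[0,1]$. "$\arg\inf$" denotes any minimizer. $Q\sim Q'$ means that $Q$ and $Q'$ differ by a column permutation. $Q$ is complete if each $e_i^\top$, $i=1,\ldots,k$ (standard basis vectors of $\mathbb R^k$), is a row of $Q$. *)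

theory Defs
  imports "HOL-Probability.Probability"
begin

(* Items are the elements of the finite type 'm, attributes those of 'k.
   Binary data are vectors over nat with entries 0 and 1, so that the library
   power has natural exponents and satisfies 0 ^ 0 = 1. *)

definition binary_vectors :: "(nat ^ 'n) set" where
  "binary_vectors = {a. \<forall>j. a $ j \<in> {0, 1}}"

definition Q_matrix :: "nat ^ 'k ^ 'm \<Rightarrow> bool" where
  "Q_matrix Q \<longleftrightarrow> (\<forall>i. row i Q \<in> binary_vectors \<and> row i Q \<noteq> 0)"

definition complete_Q :: "nat ^ 'k ^ 'm \<Rightarrow> bool" where
  "complete_Q Q \<longleftrightarrow> (\<forall>j. axis j 1 \<in> rows Q)"

definition column_equiv :: "nat ^ 'k ^ 'm \<Rightarrow> nat ^ 'k ^ 'm \<Rightarrow> bool"  (infix "\<sim>\<^sub>Q" 50) where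
  "Q \<sim>\<^sub>Q Q' \<longleftrightarrow> (\<exists>\<sigma>. \<sigma> permutes UNIV \<and> Q' = (\<chi> i j. Q $ i $ \<sigma> j))"

definition xi :: "nat ^ 'k ^ 'm \<Rightarrow> nat ^ 'k \<Rightarrow> nat ^ 'm" where
  "xi Q a = (\<chi> i. \<Prod>j\<in>UNIV. (a $ j) ^ (Q $ i $ j))"

(* A row label (combination of distinct items) is a nonempty set I of items, a
   column label is a nonzero binary vector a.  A T-matrix is the function below
   restricted to a set of row labels, which is passed separately. *)

definition T_matrix :: "real ^ 'm \<Rightarrow> real ^ 'm \<Rightarrow> nat ^ 'k ^ 'm \<Rightarrow> 'm set \<Rightarrow> nat ^ 'k \<Rightarrow> real" where
  "T_matrix c g Q I a = (\<Prod>i\<in>I. g $ i + (c $ i - g $ i) * real (xi Q a $ i))"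

abbreviation T_matrix0 :: "real ^ 'm \<Rightarrow> nat ^ 'k ^ 'm \<Rightarrow> 'm set \<Rightarrow> nat ^ 'k \<Rightarrow> real" where
  "T_matrix0 d \<equiv> T_matrix d 0"

definition saturated :: "'m set set \<Rightarrow> bool" where
  "saturated rws \<longleftrightarrow> rws = {I. I \<noteq> {}}"

definition mult_T :: "('r \<Rightarrow> nat ^ 'k \<Rightarrow> real) \<Rightarrow> (nat ^ 'k \<Rightarrow> real) \<Rightarrow> 'r \<Rightarrow> real" where
  "mult_T T p I = (\<Sum>a\<in>binary_vectors - {0}. T I a * p a)"

definition g_vec :: "real ^ 'm \<Rightarrow> 'm set \<Rightarrow> real" where
  "g_vec g I = (\<Prod>i\<in>I. g $ i)"

(* R r is the response vector of subject r, for r = 1, ..., N. *)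
definition alpha_vec :: "(nat \<Rightarrow> nat ^ 'm) \<Rightarrow> nat \<Rightarrow> 'm set \<Rightarrow> real" where
  "alpha_vec R N I = real (card {r \<in> {1..N}. \<forall>i\<in>I. R r $ i = 1}) / real N"

(* Population vectors (p_a) for all binary a, including a = 0; values at
   non-binary arguments are irrelevant everywhere. *)
definition prob_vectors :: "(nat ^ 'k \<Rightarrow> real) set" where
  "prob_vectors = {p. (\<forall>a\<in>binary_vectors. p a \<in> {0..1}) \<and> (\<Sum>a\<in>binary_vectors. p a) = 1}"

definition residual ::
  "'m set set \<Rightarrow> real ^ 'm \<Rightarrow> real ^ 'm \<Rightarrow> ('m set \<Rightarrow> real) \<Rightarrow> nat ^ 'k ^ 'm \<Rightarrow> (nat ^ 'k \<Rightarrow> real) \<Rightarrow> real" where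
  "residual rws c g \<alpha> Q p =
     L2_set (\<lambda>I. mult_T (T_matrix c g Q) p I + p 0 * g_vec g I - \<alpha> I) rws"

definition S_fun ::
  "'m set set \<Rightarrow> real ^ 'm \<Rightarrow> real ^ 'm \<Rightarrow> ('m set \<Rightarrow> real) \<Rightarrow> nat ^ 'k ^ 'm \<Rightarrow> real" where
  "S_fun rws c g \<alpha> Q = (INF p\<in>prob_vectors. residual rws c g \<alpha> Q p)"

end

theory Submission
  imports Defs
begin

text \<open>
  Let \<open>A\<close> have the law \<open>p\<close>. Given the ideal response vector, the responses are independent with means
  \<open>w i = g i + (c i - g i) * xi i\<close>, so the rows of \<open>T\<close> list the mixed moments of \<open>w\<close>, that is, the
  probabilities of joint positive responses (\<open>prob_positive_responses\<close>). Since \<open>c i\<close> and \<open>g i\<close>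
  are known and distinct, the indicator that \<open>xi\<close> equals a given vector is a product of affine
  functions of the \<open>w i\<close>. Hence the saturated moments determine the law of \<open>xi\<close> linearly, with
  coefficients that do not depend on the Q-matrix (\<open>ideal_mass_eq_sum_moments\<close>).

  A complete \<open>Q\<close> has pairwise distinct ideal response vectors, one for each attribute vector, and all of
  them have positive mass under \<open>pstar\<close>. A candidate \<open>Q'\<close> that reproduces these moments must
  therefore produce all the ideal response vectors of \<open>Q\<close>. Being equally many, the attribute vectors
  are matched bijectively. The ideal response respects meets, so the matching is an automorphism of the
  lattice of attribute sets, that is, a permutation of the attributes, and it carries the rows of \<open>Q\<close> to
  those of \<open>Q'\<close> (\<open>column_equiv_if_ideal_responses_subset\<close>). For \<open>Q' = Q\<close> the law of \<open>xi\<close> is \<open>p\<close> itself,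
  so the population is determined too.

  Linearity makes this quantitative: moments within a suitable \<open>\<delta>\<close> of the true ones already force
  the minimizing Q-matrix to be equivalent to \<open>Q\<close> and the minimizing population to be close to \<open>pstar\<close>
  (\<open>minimizers_stable\<close>). By the law of large numbers (\<open>frequency_tendsto_in_probability\<close>) the
  finitely many empirical frequencies are that close with probability tending to 1.
\<close>

section \<open>Ideal responses as sets\<close>

lemma finite_binary_vectors: "finite (binary_vectors :: (nat ^ 'n::finite) set)"
proof (rule inj_on_finite)
  show "inj_on (\<lambda>a :: nat ^ 'n. {j. a $ j = 1}) binary_vectors"
  proof (rule inj_onI)
    fix a b :: "nat ^ 'n"
    assume "a \<in> binary_vectors" "b \<in> binary_vectors" "{j. a $ j = 1} = {j. b $ j = 1}"
    then have "a $ j \<in> {0, 1}" "b $ j \<in> {0, 1}" "a $ j = 1 \<longleftrightarrow> b $ j = 1" for j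
      by (auto simp: binary_vectors_def set_eq_iff)
    then show "a = b" unfolding vec_eq_iff by (metis insert_iff singletonD)
  qed
qed auto

lemma zero_in_binary_vectors: "0 \<in> binary_vectors"
  by (simp add: binary_vectors_def)

lemma Q_matrix_entry: "Q_matrix Q \<Longrightarrow> Q $ i $ j = 0 \<or> Q $ i $ j = 1"
  by (auto simp: Q_matrix_def binary_vectors_def row_def)

lemma xi_binary:
  assumes "Q_matrix Q" "a \<in> binary_vectors"
  shows "xi Q a $ i = of_bool ({j. Q $ i $ j = 1} \<subseteq> {j. a $ j = 1})"
proof (cases "{j. Q $ i $ j = 1} \<subseteq> {j. a $ j = 1}")
  case True
  have "(a $ j) ^ (Q $ i $ j) = 1" for j
    using True Q_matrix_entry[OF assms(1), of i j] by auto
  then show ?thesis using True by (simp add: xi_def del: One_nat_def)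
next
  case False
  then obtain j where j: "Q $ i $ j = 1" "a $ j \<noteq> 1" by auto
  then have "(a $ j) ^ (Q $ i $ j) = 0"
    using assms(2) by (auto simp: binary_vectors_def)
  then show ?thesis using False by (auto simp: xi_def)
qed

lemma xi_eq_1_iff:
  assumes "Q_matrix Q" "a \<in> binary_vectors"
  shows "xi Q a $ i = 1 \<longleftrightarrow> {j. Q $ i $ j = 1} \<subseteq> {j. a $ j = 1}"
  by (simp add: xi_binary[OF assms] del: One_nat_def)

lemma xi_in_binary_vectors:
  assumes "Q_matrix Q" "a \<in> binary_vectors"
  shows "xi Q a \<in> binary_vectors"
  by (simp add: binary_vectors_def xi_binary[OF assms])

lemma xi_zero:
  assumes "Q_matrix Q"
  shows "xi Q 0 = 0"
proof -
  have "\<exists>j. Q $ i $ j = 1" for i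
  proof -
    have "row i Q \<noteq> 0" using assms by (simp add: Q_matrix_def)
    then obtain j where "Q $ i $ j \<noteq> 0" by (auto simp: row_def vec_eq_iff)
    then show ?thesis using Q_matrix_entry[OF assms, of i j] by auto
  qed
  then show ?thesis
    by (auto simp: vec_eq_iff xi_binary[OF assms zero_in_binary_vectors])
qed

lemma complete_Q_row:
  assumes "complete_Q Q"
  shows "\<exists>i. {l. Q $ i $ l = 1} = {j}"
proof -
  obtain i where "axis j 1 = row i Q"
    using assms by (auto simp: complete_Q_def rows_def)
  then have "Q $ i $ l = (if l = j then 1 else 0)" for l
    by (simp add: row_def axis_def vec_eq_iff) metis
  then have "{l. Q $ i $ l = 1} = {j}" by auto
  then show ?thesis by blast
qed

lemma inj_on_xi:
  assumes "Q_matrix Q" "complete_Q Q"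
  shows "inj_on (xi Q) binary_vectors"
proof (rule inj_onI)
  fix a b assume ab: "a \<in> binary_vectors" "b \<in> binary_vectors" "xi Q a = xi Q b"
  have "a $ j = b $ j" for j
  proof -
    obtain i where i: "{l. Q $ i $ l = 1} = {j}" using complete_Q_row[OF assms(2)] by blast
    have "xi Q a $ i = xi Q b $ i" using ab by simp
    then have "a $ j = 1 \<longleftrightarrow> b $ j = 1"
      using xi_eq_1_iff[OF assms(1) ab(1), of i] xi_eq_1_iff[OF assms(1) ab(2), of i]
      by (simp add: i del: One_nat_def)
    then show ?thesis using ab(1,2) by (force simp: binary_vectors_def)
  qed
  then show "a = b" by (simp add: vec_eq_iff)
qed

section \<open>Identifiability of the Q-matrix\<close>

text \<open>
  An automorphism of the lattice of subsets permutes the atoms, and a set is determined by the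
  atoms below it.
\<close>

lemma order_automorphism_set:
  fixes \<phi> :: "'k::finite set \<Rightarrow> 'k set"
  assumes mono: "\<And>S T. \<phi> S \<subseteq> \<phi> T \<longleftrightarrow> S \<subseteq> T"
  obtains \<tau> where "bij \<tau>" "\<And>S. \<phi> S = \<tau> ` S"
proof -
  have inj: "inj \<phi>" by (rule injI) (metis mono order_antisym order_refl)
  then have surj: "surj \<phi>" by (simp add: finite_UNIV_inj_surj)
  have empty: "\<phi> {} = {}"
    using surj mono by (metis empty_subsetI subset_empty surjD)
  have "\<exists>t. \<phi> {j} = {t}" for j
  proof -
    have "\<phi> {j} \<noteq> {}" using inj empty by (metis injD insert_not_empty)
    then obtain t where t: "t \<in> \<phi> {j}" by blast
    obtain S where S: "\<phi> S = {t}" using surj by (metis surjD)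
    then have "S \<subseteq> {j}" using t mono[of S "{j}"] by simp
    moreover have "S \<noteq> {}" using S empty by auto
    ultimately have "S = {j}" by auto
    then show ?thesis using S by blast
  qed
  then obtain \<tau> where \<tau>: "\<And>j. \<phi> {j} = {\<tau> j}" by metis
  have "inj \<tau>" by (rule injI) (metis \<tau> inj injD singleton_inject)
  then have bij: "bij \<tau>" by (simp add: bij_def finite_UNIV_inj_surj)
  have mem: "\<tau> j \<in> \<phi> S \<longleftrightarrow> j \<in> S" for j S
    using mono[of "{j}" S] by (simp add: \<tau>)
  have "\<phi> S = \<tau> ` S" for S
  proof (rule set_eqI)
    fix t
    obtain j where "t = \<tau> j" using bij by (metis bij_pointE)
    then show "t \<in> \<phi> S \<longleftrightarrow> t \<in> \<tau> ` S"
      using mem \<open>inj \<tau>\<close> by (simp add: inj_image_mem_iff)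
  qed
  with bij that show thesis by blast
qed

text \<open>
  Sending a set of attributes \<open>S\<close> to the set \<open>X Q S\<close> of items that a subject with exactly these
  attributes masters preserves intersections, and for a complete \<open>Q\<close> it reflects inclusion.
  If every ideal response pattern under \<open>Q\<close> also occurs under \<open>Q'\<close>, then by counting the patterns of
  \<open>Q'\<close> are pairwise distinct, so \<open>X Q'\<close> is an order embedding as well. Passing from one encoding of
  the patterns to the other is then an automorphism of the subset lattice. The row of an item is the
  least attribute set that masters it, hence it is carried along by the same permutation.
  Completeness of \<open>Q'\<close> is not assumed but follows.
\<close>

lemma column_equiv_if_ideal_responses_subset:
  fixes Q Q' :: "nat ^ 'k::finite ^ 'm::finite"
  assumes Q: "Q_matrix Q" and Q': "Q_matrix Q'" and complete: "complete_Q Q"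
    and sub: "xi Q ` binary_vectors \<subseteq> xi Q' ` binary_vectors"
  shows "Q' \<sim>\<^sub>Q Q"
proof -
  define X where "X = (\<lambda>(Q :: nat ^ 'k ^ 'm) S. {i. {j. Q $ i $ j = 1} \<subseteq> S})"
  define bv where "bv = (\<lambda>S :: 'k set. (\<chi> j. of_bool (j \<in> S)) :: nat ^ 'k)"
  have bv: "bv S \<in> binary_vectors" "{j. bv S $ j = 1} = S" for S
    by (auto simp: bv_def binary_vectors_def)
  have "\<exists>T. X Q S = X Q' T" for S
  proof -
    obtain b where b: "b \<in> binary_vectors" "xi Q (bv S) = xi Q' b"
      using sub bv(1) by blast
    have "X Q S = X Q' {j. b $ j = 1}"
      using xi_eq_1_iff[OF Q bv(1), of S] xi_eq_1_iff[OF Q' b(1)]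
      by (simp add: X_def bv(2) b(2) del: One_nat_def)
    then show ?thesis by blast
  qed
  then obtain \<phi> where \<phi>: "\<And>S. X Q S = X Q' (\<phi> S)" by metis
  have XQ: "X Q S \<subseteq> X Q T \<longleftrightarrow> S \<subseteq> T" for S T
  proof
    assume le: "X Q S \<subseteq> X Q T"
    show "S \<subseteq> T"
    proof
      fix j assume "j \<in> S"
      obtain i where "{l. Q $ i $ l = 1} = {j}" using complete_Q_row[OF complete] by blast
      with le \<open>j \<in> S\<close> show "j \<in> T" by (auto simp: X_def)
    qed
  qed (auto simp: X_def)
  \<comment> \<open>Counting step: the injection \<open>\<phi>\<close> of the finite power set into itself is onto, so all
    values of \<open>X Q'\<close> are values of \<open>X Q\<close>, and \<open>X Q'\<close> is injective.\<close>
  have "inj \<phi>" by (rule injI) (metis XQ \<phi> order_antisym order_refl)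
  then have surj: "surj \<phi>" by (simp add: finite_UNIV_inj_surj)
  have inj': "S = T" if "X Q' S = X Q' T" for S T
    using that surj by (metis XQ \<phi> order_antisym order_refl surjD)
  have "\<phi> S \<subseteq> \<phi> T \<longleftrightarrow> S \<subseteq> T" for S T
  proof
    assume "\<phi> S \<subseteq> \<phi> T"
    then have "X Q' (\<phi> S) \<subseteq> X Q' (\<phi> T)" by (auto simp: X_def)
    then show "S \<subseteq> T" by (simp add: XQ flip: \<phi>)
  next
    assume "S \<subseteq> T"
    then have "X Q' (\<phi> S) \<subseteq> X Q' (\<phi> T)" by (simp add: XQ flip: \<phi>)
    \<comment> \<open>The map from attribute sets to ideal responses preserves intersections.\<close>
    then have "X Q' (\<phi> S \<inter> \<phi> T) = X Q' (\<phi> S)" by (auto simp: X_def)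
    then show "\<phi> S \<subseteq> \<phi> T" using inj' by blast
  qed
  then obtain \<tau> where \<tau>: "bij \<tau>" "\<And>S. \<phi> S = \<tau> ` S"
    using order_automorphism_set by metis
  have le: "{j. Q $ i $ j = 1} \<subseteq> S \<longleftrightarrow> {j. Q' $ i $ j = 1} \<subseteq> \<tau> ` S" for i S
    using \<phi>[of S] by (auto simp: X_def \<tau>(2))
  have rows: "{j. Q' $ i $ j = 1} = \<tau> ` {j. Q $ i $ j = 1}" for i
  proof
    show "{j. Q' $ i $ j = 1} \<subseteq> \<tau> ` {j. Q $ i $ j = 1}" using le by blast
    have "\<tau> ` (\<tau> -` {j. Q' $ i $ j = 1}) = {j. Q' $ i $ j = 1}"
      by (rule surj_image_vimage_eq[OF bij_is_surj[OF \<tau>(1)]])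
    then have "{j. Q $ i $ j = 1} \<subseteq> \<tau> -` {j. Q' $ i $ j = 1}"
      by (simp only: le)
    then show "\<tau> ` {j. Q $ i $ j = 1} \<subseteq> {j. Q' $ i $ j = 1}" by blast
  qed
  have "Q $ i $ j = 1 \<longleftrightarrow> Q' $ i $ \<tau> j = 1" for i j
  proof -
    have "\<tau> j \<in> {j. Q' $ i $ j = 1} \<longleftrightarrow> j \<in> {j. Q $ i $ j = 1}"
      using \<tau>(1) unfolding rows by (simp add: bij_is_inj inj_image_mem_iff)
    then show ?thesis by simp
  qed
  then have "Q = (\<chi> i j. Q' $ i $ \<tau> j)"
    using Q_matrix_entry[OF Q] Q_matrix_entry[OF Q'] by (simp add: vec_eq_iff) (metis zero_neq_one)
  moreover have "\<tau> permutes UNIV" by (rule bij_imp_permutes) (use \<tau>(1) in auto)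
  ultimately show ?thesis by (auto simp: column_equiv_def)
qed

section \<open>Recovering the law of the ideal responses from the moments\<close>

text \<open>
  The model probability that all items in \<open>I\<close> are answered positively, when the attribute vectors
  have the distribution \<open>p\<close>. The last summand is the contribution of \<open>a = 0\<close>, for which no item is
  mastered if \<open>Q\<close> has no zero row. For \<open>I = {}\<close> the moment is the total mass of \<open>p\<close>.
\<close>

definition response_moment ::
  "real ^ 'm \<Rightarrow> real ^ 'm \<Rightarrow> nat ^ 'k ^ 'm \<Rightarrow> (nat ^ 'k \<Rightarrow> real) \<Rightarrow> 'm set \<Rightarrow> real" where
  "response_moment c g Q p I = mult_T (T_matrix c g Q) p I + p 0 * g_vec g I"

text \<open>The mass that \<open>p\<close> gives to the ideal response vector \<open>x\<close> under \<open>Q\<close>.\<close>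

definition ideal_mass :: "nat ^ 'k ^ 'm \<Rightarrow> (nat ^ 'k \<Rightarrow> real) \<Rightarrow> nat ^ 'm \<Rightarrow> real" where
  "ideal_mass Q p x = (\<Sum>a\<in>{a\<in>binary_vectors. xi Q a = x}. p a)"

lemma response_moment_eq_sum:
  fixes Q :: "nat ^ 'k::finite ^ 'm::finite"
  assumes "Q_matrix Q"
  shows "response_moment c g Q p I = (\<Sum>a\<in>binary_vectors. T_matrix c g Q I a * p a)"
proof -
  have "T_matrix c g Q I 0 = g_vec g I"
    by (simp add: T_matrix_def g_vec_def xi_zero[OF assms])
  then show ?thesis
    unfolding response_moment_def mult_T_def
    by (simp add: sum.remove[OF finite_binary_vectors zero_in_binary_vectors] mult.commute add.commute)
qed

lemma response_moment_empty:
  fixes Q :: "nat ^ 'k::finite ^ 'm::finite"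
  assumes "Q_matrix Q" "p \<in> prob_vectors"
  shows "response_moment c g Q p {} = 1"
  using assms(2) by (simp add: response_moment_eq_sum[OF assms(1)] T_matrix_def prob_vectors_def)

text \<open>
  The coefficients that invert the moments. For a binary \<open>x\<close> and \<open>w i = g i + (c i - g i) * x i\<close> the
  indicator of \<open>x i = y i\<close> is \<open>(w i - g i) / (c i - g i)\<close> if \<open>y i = 1\<close> and
  \<open>(c i - w i) / (c i - g i)\<close> if \<open>y i = 0\<close>. The product of these affine functions over all items
  expands into products of \<open>w\<close> over sets \<open>I\<close> of items, and \<open>moment_coeff c g y I\<close> is the
  coefficient belonging to \<open>I\<close>.
\<close>

definition moment_coeff :: "real ^ 'm \<Rightarrow> real ^ 'm \<Rightarrow> nat ^ 'm \<Rightarrow> 'm set \<Rightarrow> real" where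
  "moment_coeff c g y I =
     (\<Prod>i\<in>I. (if y $ i = 1 then 1 else - 1) / (c $ i - g $ i)) *
     (\<Prod>i\<in>- I. (if y $ i = 1 then - g $ i else c $ i) / (c $ i - g $ i))"

lemma of_bool_xi_eq_sum:
  fixes Q :: "nat ^ 'k::finite ^ 'm::finite"
  assumes Q: "Q_matrix Q" and neq: "\<And>i. c $ i \<noteq> g $ i"
    and a: "a \<in> binary_vectors" and y: "y \<in> binary_vectors"
  shows "of_bool (xi Q a = y) = (\<Sum>I\<in>UNIV. moment_coeff c g y I * T_matrix c g Q I a)"
proof -
  define u where "u i = (if y $ i = 1 then - g $ i else c $ i) / (c $ i - g $ i)" for i
  define v where "v i = (if y $ i = 1 then 1 else - 1) / (c $ i - g $ i)" for i
  define w where "w i = g $ i + (c $ i - g $ i) * real (xi Q a $ i)" for i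
  have factor: "of_bool (xi Q a $ i = y $ i) = v i * w i + u i" for i
  proof -
    have "xi Q a $ i \<in> {0, 1}" "y $ i \<in> {0, 1}"
      using xi_in_binary_vectors[OF Q a] y by (auto simp: binary_vectors_def)
    moreover have "c $ i - g $ i \<noteq> 0" using neq[of i] by simp
    ultimately show ?thesis
      by (auto simp: u_def v_def w_def minus_divide_left simp flip: add_divide_distrib diff_divide_distrib)
  qed
  have coeff: "moment_coeff c g y I = prod v I * prod u (UNIV - I)" for I
    by (simp add: moment_coeff_def u_def v_def Compl_eq_Diff_UNIV)
  have T: "T_matrix c g Q I a = prod w I" for I
    by (simp add: T_matrix_def w_def)
  have "of_bool (xi Q a = y) = (\<Prod>i\<in>UNIV. of_bool (xi Q a $ i = y $ i) :: real)"
    by (auto simp: vec_eq_iff of_bool_def)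
  also have "\<dots> = (\<Prod>i\<in>UNIV. v i * w i + u i)" by (simp only: factor)
  also have "\<dots> = (\<Sum>I\<in>Pow UNIV. (\<Prod>i\<in>I. v i * w i) * (\<Prod>i\<in>UNIV - I. u i))"
    by (rule prod_add) simp
  also have "\<dots> = (\<Sum>I\<in>UNIV. moment_coeff c g y I * T_matrix c g Q I a)"
    by (simp add: coeff T prod.distrib mult_ac)
  finally show ?thesis .
qed

lemma ideal_mass_eq_sum_moments:
  fixes Q :: "nat ^ 'k::finite ^ 'm::finite"
  assumes Q: "Q_matrix Q" and neq: "\<And>i. c $ i \<noteq> g $ i" and y: "y \<in> binary_vectors"
  shows "ideal_mass Q p y = (\<Sum>I\<in>UNIV. moment_coeff c g y I * response_moment c g Q p I)"
proof -
  have "ideal_mass Q p y = (\<Sum>a\<in>binary_vectors. of_bool (xi Q a = y) * p a)"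
    unfolding ideal_mass_def
    by (intro sum.mono_neutral_cong_left) (auto simp: finite_binary_vectors)
  also have "\<dots> = (\<Sum>a\<in>binary_vectors. \<Sum>I\<in>UNIV. moment_coeff c g y I * (T_matrix c g Q I a * p a))"
    by (intro sum.cong refl) (simp add: of_bool_xi_eq_sum[OF Q neq _ y] sum_distrib_right mult.assoc)
  also have "\<dots> = (\<Sum>I\<in>UNIV. moment_coeff c g y I * response_moment c g Q p I)"
    by (subst sum.swap) (simp add: response_moment_eq_sum[OF Q] sum_distrib_left)
  finally show ?thesis .
qed

text \<open>
  The inversion is linear with coefficients that depend on neither the Q-matrix nor the population,
  so one Lipschitz constant serves all pairs.
\<close>

lemma ideal_mass_Lipschitz:
  fixes c g :: "real ^ 'm::finite"
  assumes neq: "\<And>i. c $ i \<noteq> g $ i"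
  obtains K where "K > 0"
    "\<And>(Q :: nat ^ 'k::finite ^ 'm) (Q' :: nat ^ 'k ^ 'm) p p' \<eta> y.
       \<lbrakk>Q_matrix Q; Q_matrix Q'; p \<in> prob_vectors; p' \<in> prob_vectors; 0 \<le> \<eta>;
        \<And>I. I \<noteq> {} \<Longrightarrow> \<bar>response_moment c g Q p I - response_moment c g Q' p' I\<bar> \<le> \<eta>;
        y \<in> binary_vectors\<rbrakk>
       \<Longrightarrow> \<bar>ideal_mass Q p y - ideal_mass Q' p' y\<bar> \<le> K * \<eta>"
proof -
  \<comment> \<open>The summand 1 serves only to make \<open>K\<close> positive.\<close>
  define K where "K = 1 + (\<Sum>y\<in>binary_vectors. \<Sum>I\<in>UNIV. \<bar>moment_coeff c g y I\<bar>)"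
  have "K > 0" unfolding K_def by (intro add_pos_nonneg sum_nonneg) auto
  then show thesis
  proof (rule that)
    fix Q Q' :: "nat ^ 'k ^ 'm" and p p' \<eta> and y :: "nat ^ 'm"
    assume Q: "Q_matrix Q" "Q_matrix Q'" and p: "p \<in> prob_vectors" "p' \<in> prob_vectors"
      and \<eta>: "0 \<le> \<eta>" and y: "y \<in> binary_vectors"
      and close: "\<And>I. I \<noteq> {} \<Longrightarrow> \<bar>response_moment c g Q p I - response_moment c g Q' p' I\<bar> \<le> \<eta>"
    have close': "\<bar>response_moment c g Q p I - response_moment c g Q' p' I\<bar> \<le> \<eta>" for I
      using close[of I] Q p \<eta> by (cases "I = {}") (auto simp: response_moment_empty)
    have "\<bar>ideal_mass Q p y - ideal_mass Q' p' y\<bar> =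
        \<bar>\<Sum>I\<in>UNIV. moment_coeff c g y I * (response_moment c g Q p I - response_moment c g Q' p' I)\<bar>"
      by (simp add: ideal_mass_eq_sum_moments[OF _ neq y] Q right_diff_distrib sum_subtractf)
    also have "\<dots> \<le> (\<Sum>I\<in>UNIV. \<bar>moment_coeff c g y I\<bar> * \<eta>)"
      by (intro order_trans[OF sum_abs] sum_mono)
         (simp add: abs_mult mult_left_mono[OF close'])
    also have "\<dots> = (\<Sum>I\<in>UNIV. \<bar>moment_coeff c g y I\<bar>) * \<eta>"
      by (simp add: sum_distrib_right)
    also have "\<dots> \<le> K * \<eta>"
    proof (rule mult_right_mono[OF _ \<eta>])
      have "(\<Sum>I\<in>UNIV. \<bar>moment_coeff c g y I\<bar>) \<le>
          (\<Sum>y\<in>binary_vectors. \<Sum>I\<in>UNIV. \<bar>moment_coeff c g y I\<bar>)"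
        using y by (intro member_le_sum) (auto simp: finite_binary_vectors sum_nonneg)
      then show "(\<Sum>I\<in>UNIV. \<bar>moment_coeff c g y I\<bar>) \<le> K" by (simp add: K_def)
    qed
    finally show "\<bar>ideal_mass Q p y - ideal_mass Q' p' y\<bar> \<le> K * \<eta>" .
  qed
qed

lemma ideal_mass_complete:
  fixes Q :: "nat ^ 'k::finite ^ 'm::finite"
  assumes "Q_matrix Q" "complete_Q Q" "a \<in> binary_vectors"
  shows "ideal_mass Q p (xi Q a) = p a"
proof -
  have "{b \<in> binary_vectors. xi Q b = xi Q a} = {a}"
    using inj_on_xi[OF assms(1,2)] assms(3) by (auto simp: inj_on_def)
  then show ?thesis by (simp add: ideal_mass_def)
qed

section \<open>Stability of the minimizers\<close>

lemma residual_alt: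
  "residual rws c g \<alpha> Q p = L2_set (\<lambda>I. response_moment c g Q p I - \<alpha> I) rws"
  by (simp add: residual_def response_moment_def)

text \<open>
  If \<open>\<alpha>\<close> is close to the true moments, the residual at the true parameters is small, and hence so is
  the residual at the minimizer. The moments of the fitted model are then close to the true
  ones, and so are the masses of the ideal response vectors. Once the error is below the smallest
  \<open>pstar a\<close>, no ideal response vector of \<open>Q\<close> can have mass zero in the fitted model, which
  identifies \<open>Q\<close> up to columns. The distance is explicit, so no compactness argument is needed.
\<close>

lemma minimizers_stable:
  fixes Q :: "nat ^ 'k::finite ^ 'm::finite"
  assumes Q: "Q_matrix Q" and complete: "complete_Q Q" and rws: "saturated rws"
    and neq: "\<And>i. c $ i \<noteq> g $ i"
    and pstar: "pstar \<in> prob_vectors" and pos: "\<And>a. a \<in> binary_vectors \<Longrightarrow> pstar a > 0"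
    and \<epsilon>: "\<epsilon> > 0"
  obtains \<delta> where "\<delta> > 0"
    "\<And>\<alpha> Q'. \<lbrakk>\<And>I. I \<noteq> {} \<Longrightarrow> \<bar>\<alpha> I - response_moment c g Q pstar I\<bar> < \<delta>;
        is_arg_min (S_fun rws c g \<alpha>) Q_matrix Q'\<rbrakk> \<Longrightarrow> Q' \<sim>\<^sub>Q Q"
    "\<And>\<alpha> p a. \<lbrakk>\<And>I. I \<noteq> {} \<Longrightarrow> \<bar>\<alpha> I - response_moment c g Q pstar I\<bar> < \<delta>;
        is_arg_min (\<lambda>p. (residual rws c g \<alpha> Q p)\<^sup>2) (\<lambda>p. p \<in> prob_vectors) p;
        a \<in> binary_vectors\<rbrakk> \<Longrightarrow> \<bar>p a - pstar a\<bar> \<le> \<epsilon>"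
proof -
  obtain K where K: "K > 0"
    "\<And>(Q :: nat ^ 'k::finite ^ 'm) (Q' :: nat ^ 'k ^ 'm) p p' \<eta> y.
       \<lbrakk>Q_matrix Q; Q_matrix Q'; p \<in> prob_vectors; p' \<in> prob_vectors; 0 \<le> \<eta>;
        \<And>I. I \<noteq> {} \<Longrightarrow> \<bar>response_moment c g Q p I - response_moment c g Q' p' I\<bar> \<le> \<eta>;
        y \<in> binary_vectors\<rbrakk>
       \<Longrightarrow> \<bar>ideal_mass Q p y - ideal_mass Q' p' y\<bar> \<le> K * \<eta>"
    using ideal_mass_Lipschitz[OF neq] by blast
  have ne: "binary_vectors \<noteq> ({} :: (nat ^ 'k) set)" using zero_in_binary_vectors by blast
  define \<rho> where "\<rho> = Min (pstar ` binary_vectors)"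
  have \<rho>: "\<rho> > 0" "\<And>a. a \<in> binary_vectors \<Longrightarrow> \<rho> \<le> pstar a"
    using pos ne by (auto simp: \<rho>_def finite_binary_vectors)
  \<comment> \<open>The residual is at most the number of rows times the largest deviation of a moment. The
    added 1 makes this bound strict, so that the infimum in \<open>S_fun\<close> is undercut by an actual
    population. Two deviations of size \<open>n * \<delta>\<close> must leave the mass error below \<open>min \<rho> \<epsilon>\<close>.\<close>
  define n where "n = real (card rws) + 1"
  define \<delta> where "\<delta> = min \<rho> \<epsilon> / (3 * K * n)"
  have n: "n > 0" by (simp add: n_def add_nonneg_pos)
  have \<delta>: "\<delta> > 0" using \<rho>(1) \<epsilon> K(1) n by (simp add: \<delta>_def)
  have "K * (2 * (n * \<delta>)) = min \<rho> \<epsilon> * (2 / 3)" using K(1) n by (simp add: \<delta>_def field_simps)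
  also have "\<dots> < min \<rho> \<epsilon>" using \<rho>(1) \<epsilon> by (simp add: min_def)
  finally have small: "K * (2 * (n * \<delta>)) < min \<rho> \<epsilon>" .
  have rws_eq: "rws = {I. I \<noteq> {}}" using rws by (simp add: saturated_def)
  have fin: "finite rws" by simp

  have res_star: "residual rws c g \<alpha> Q pstar < n * \<delta>"
    if close: "\<And>I. I \<noteq> {} \<Longrightarrow> \<bar>\<alpha> I - response_moment c g Q pstar I\<bar> < \<delta>" for \<alpha>
  proof -
    have "residual rws c g \<alpha> Q pstar \<le> (\<Sum>I\<in>rws. \<bar>response_moment c g Q pstar I - \<alpha> I\<bar>)"
      unfolding residual_alt by (rule L2_set_le_sum_abs)
    also have "\<dots> \<le> (\<Sum>I\<in>rws. \<delta>)"
      using close by (intro sum_mono) (simp add: rws_eq abs_minus_commute less_imp_le)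
    also have "\<dots> < n * \<delta>" using \<delta> by (simp add: n_def algebra_simps)
    finally show ?thesis .
  qed
  have masses: "\<bar>ideal_mass Q' p y - ideal_mass Q pstar y\<bar> \<le> K * (2 * (n * \<delta>))"
    if close: "\<And>I. I \<noteq> {} \<Longrightarrow> \<bar>\<alpha> I - response_moment c g Q pstar I\<bar> < \<delta>"
      and Q': "Q_matrix Q'" and p: "p \<in> prob_vectors" and y: "y \<in> binary_vectors"
      and res: "residual rws c g \<alpha> Q' p \<le> n * \<delta>"
    for \<alpha> p y and Q' :: "nat ^ 'k ^ 'm"
  proof (rule K(2)[OF Q' Q p pstar _ _ y])
    show "0 \<le> 2 * (n * \<delta>)" using n \<delta> by simp
    fix I :: "'m set" assume I: "I \<noteq> {}"
    have "\<bar>response_moment c g Q' p I - \<alpha> I\<bar> \<le>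
        L2_set (\<lambda>I. \<bar>response_moment c g Q' p I - \<alpha> I\<bar>) rws"
      using I by (intro member_le_L2_set fin) (simp add: rws_eq)
    also have "\<dots> \<le> n * \<delta>" using res by (simp add: residual_alt L2_set_def)
    finally have 1: "\<bar>response_moment c g Q' p I - \<alpha> I\<bar> \<le> n * \<delta>" .
    have "\<delta> \<le> n * \<delta>" using \<delta> by (simp add: n_def)
    with 1 close[OF I]
    show "\<bar>response_moment c g Q' p I - response_moment c g Q pstar I\<bar> \<le> 2 * (n * \<delta>)"
      by linarith
  qed

  show thesis
  proof (rule that[OF \<delta>])
    fix \<alpha> and Q' :: "nat ^ 'k ^ 'm"
    assume close: "\<And>I. I \<noteq> {} \<Longrightarrow> \<bar>\<alpha> I - response_moment c g Q pstar I\<bar> < \<delta>"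
      and min: "is_arg_min (S_fun rws c g \<alpha>) Q_matrix Q'"
    have Q': "Q_matrix Q'" using min by (simp add: is_arg_min_def)
    have bdd: "bdd_below (residual rws c g \<alpha> Q'' ` prob_vectors)" for Q'' :: "nat ^ 'k ^ 'm"
      by (rule bdd_belowI2[of _ 0]) (simp add: residual_def)
    have "S_fun rws c g \<alpha> Q' \<le> S_fun rws c g \<alpha> Q"
      using min Q by (auto simp: is_arg_min_def not_less)
    also have "\<dots> \<le> residual rws c g \<alpha> Q pstar"
      unfolding S_fun_def by (rule cINF_lower[OF bdd pstar])
    also have "\<dots> < n * \<delta>" by (rule res_star[OF close])
    finally obtain p where p: "p \<in> prob_vectors" "residual rws c g \<alpha> Q' p < n * \<delta>"
      unfolding S_fun_def using pstar bdd by (subst (asm) cINF_less_iff) auto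
    have "xi Q ` binary_vectors \<subseteq> xi Q' ` binary_vectors"
    proof (rule image_subsetI, rule ccontr)
      fix a :: "nat ^ 'k" assume a: "a \<in> binary_vectors" and "xi Q a \<notin> xi Q' ` binary_vectors"
      then have "{b \<in> binary_vectors. xi Q' b = xi Q a} = {}" by force
      then have "ideal_mass Q' p (xi Q a) = 0" by (simp only: ideal_mass_def sum.empty)
      then have "\<bar>pstar a\<bar> \<le> K * (2 * (n * \<delta>))"
        using masses[OF close Q' p(1) xi_in_binary_vectors[OF Q a]] p(2)
        by (simp add: ideal_mass_complete[OF Q complete a])
      with small \<rho>(2)[OF a] show False by linarith
    qed
    then show "Q' \<sim>\<^sub>Q Q" by (rule column_equiv_if_ideal_responses_subset[OF Q Q' complete])
  next
    fix \<alpha> p and a :: "nat ^ 'k"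
    assume close: "\<And>I. I \<noteq> {} \<Longrightarrow> \<bar>\<alpha> I - response_moment c g Q pstar I\<bar> < \<delta>"
      and min: "is_arg_min (\<lambda>p. (residual rws c g \<alpha> Q p)\<^sup>2) (\<lambda>p. p \<in> prob_vectors) p"
      and a: "a \<in> binary_vectors"
    have p: "p \<in> prob_vectors" using min by (simp add: is_arg_min_def)
    have "(residual rws c g \<alpha> Q p)\<^sup>2 \<le> (residual rws c g \<alpha> Q pstar)\<^sup>2"
      using min pstar by (auto simp: is_arg_min_def not_less)
    then have "residual rws c g \<alpha> Q p \<le> residual rws c g \<alpha> Q pstar"
      by (rule power2_le_imp_le) (simp add: residual_def)
    also have "\<dots> < n * \<delta>" by (rule res_star[OF close])
    finally have "\<bar>p a - pstar a\<bar> \<le> K * (2 * (n * \<delta>))"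
      using masses[OF close Q p xi_in_binary_vectors[OF Q a]]
      by (simp add: ideal_mass_complete[OF Q complete a])
    with small show "\<bar>p a - pstar a\<bar> \<le> \<epsilon>" by linarith
  qed
qed

section \<open>The law of the responses\<close>

lemma (in prob_space) cond_prob_sum:
  assumes "finite F"
    and "\<And>n. n \<in> F \<Longrightarrow> {\<omega> \<in> space M. E n \<omega> \<and> C \<omega>} \<in> events"
    and "{\<omega> \<in> space M. B \<omega> \<and> C \<omega>} \<in> events"
    and "\<And>\<omega>. \<omega> \<in> space M \<Longrightarrow> B \<omega> \<Longrightarrow> \<exists>!n\<in>F. E n \<omega>"
    and "\<And>\<omega> n. \<omega> \<in> space M \<Longrightarrow> n \<in> F \<Longrightarrow> E n \<omega> \<Longrightarrow> B \<omega>"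
  shows "\<P>(\<omega> in M. B \<omega> \<bar> C \<omega>) = (\<Sum>n\<in>F. \<P>(\<omega> in M. E n \<omega> \<bar> C \<omega>))"
proof -
  have "\<P>(\<omega> in M. B \<omega> \<and> C \<omega>) = (\<Sum>n\<in>F. \<P>(\<omega> in M. E n \<omega> \<and> C \<omega>))"
    using assms by (intro prob_sum AE_I2) blast+
  then show ?thesis by (simp add: cond_prob_def sum_divide_distrib)
qed

text \<open>
  Under the response model the probability of a joint positive response is the model moment. The
  conditional law of the whole response vector, which is a product, is summed over the vectors that
  are 1 on \<open>I\<close>, and the result is averaged over the ideal response vectors.
\<close>

lemma (in prob_space) prob_positive_responses:
  fixes Q :: "nat ^ 'k::finite ^ 'm::finite" and A :: "'a \<Rightarrow> nat ^ 'k" and R :: "'a \<Rightarrow> nat ^ 'm"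
  assumes Q: "Q_matrix Q"
    and meas: "(\<lambda>\<omega>. (A \<omega>, R \<omega>)) \<in> M \<rightarrow>\<^sub>M count_space (binary_vectors \<times> binary_vectors)"
    and law: "\<And>a. a \<in> binary_vectors \<Longrightarrow> \<P>(\<omega> in M. A \<omega> = a) = p a"
    and indep: "\<And>x y. \<P>(\<omega> in M. xi Q (A \<omega>) = x) > 0 \<Longrightarrow>
         \<P>(\<omega> in M. R \<omega> = y \<bar> xi Q (A \<omega>) = x) =
           (\<Prod>i\<in>UNIV. \<P>(\<omega> in M. R \<omega> $ i = y $ i \<bar> xi Q (A \<omega>) = x))"
    and dist: "\<And>x i. \<P>(\<omega> in M. xi Q (A \<omega>) = x) > 0 \<Longrightarrow>
         \<P>(\<omega> in M. R \<omega> $ i = 1 \<bar> xi Q (A \<omega>) = x) = (c $ i) ^ (x $ i) * (g $ i) ^ (1 - x $ i)"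
  shows "\<P>(\<omega> in M. \<forall>i\<in>I. R \<omega> $ i = 1) = response_moment c g Q p I"
proof -
  have bin: "A \<omega> \<in> binary_vectors" "R \<omega> \<in> binary_vectors" if "\<omega> \<in> space M" for \<omega>
    using measurable_space[OF meas that] by auto
  have R01: "R \<omega> $ i = 0 \<or> R \<omega> $ i = 1" if "\<omega> \<in> space M" for \<omega> i
    using bin(2)[OF that] by (auto simp: binary_vectors_def)
  have ev: "{\<omega> \<in> space M. P (A \<omega>) (R \<omega>)} \<in> events" for P
  proof -
    have "(\<lambda>\<omega>. (A \<omega>, R \<omega>)) -` {z \<in> binary_vectors \<times> binary_vectors. P (fst z) (snd z)} \<inter> space M \<in> events"
      by (rule measurable_sets[OF meas]) auto
    also have "(\<lambda>\<omega>. (A \<omega>, R \<omega>)) -` {z \<in> binary_vectors \<times> binary_vectors. P (fst z) (snd z)} \<inter> space M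
        = {\<omega> \<in> space M. P (A \<omega>) (R \<omega>)}"
      using bin by auto
    finally show ?thesis .
  qed
  define E where "E \<omega> \<longleftrightarrow> (\<forall>i\<in>I. R \<omega> $ i = 1)" for \<omega>
  have cond: "\<P>(\<omega> in M. E \<omega> \<bar> xi Q (A \<omega>) = x) = (\<Prod>i\<in>I. (c $ i) ^ (x $ i) * (g $ i) ^ (1 - x $ i))"
    if pos: "\<P>(\<omega> in M. xi Q (A \<omega>) = x) > 0" for x
  proof -
    \<comment> \<open>The values that the response to an item may take when all items in \<open>I\<close> are answered positively.\<close>
    define B :: "'m \<Rightarrow> nat set" where "B i = (if i \<in> I then {1} else {0, 1})" for i
    have marginal: "(\<Sum>b\<in>B i. \<P>(\<omega> in M. R \<omega> $ i = b \<bar> xi Q (A \<omega>) = x)) =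
        (if i \<in> I then (c $ i) ^ (x $ i) * (g $ i) ^ (1 - x $ i) else 1)" for i
    proof (cases "i \<in> I")
      case True
      then show ?thesis using dist[OF pos] by (simp add: B_def)
    next
      case False
      have "(\<Sum>b\<in>B i. \<P>(\<omega> in M. R \<omega> $ i = b \<bar> xi Q (A \<omega>) = x)) = \<P>(\<omega> in M. True \<bar> xi Q (A \<omega>) = x)"
      proof (rule cond_prob_sum[symmetric])
        show "finite (B i)" by (simp add: B_def)
        show "{\<omega> \<in> space M. R \<omega> $ i = b \<and> xi Q (A \<omega>) = x} \<in> events" for b
          by (rule ev[of "\<lambda>a r. r $ i = b \<and> xi Q a = x"])
        show "{\<omega> \<in> space M. True \<and> xi Q (A \<omega>) = x} \<in> events"
          by (rule ev[of "\<lambda>a r. True \<and> xi Q a = x"])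
        show "\<exists>!b\<in>B i. R \<omega> $ i = b" if "\<omega> \<in> space M" for \<omega>
          using R01[OF that, of i] False by (auto simp: B_def)
      qed auto
      also have "\<dots> = 1" using pos by (simp add: cond_prob_def)
      finally show ?thesis using False by simp
    qed
    have "\<P>(\<omega> in M. E \<omega> \<bar> xi Q (A \<omega>) = x) =
        (\<Sum>f\<in>PiE UNIV B. \<P>(\<omega> in M. R \<omega> = (\<chi> i. f i) \<bar> xi Q (A \<omega>) = x))"
    proof (rule cond_prob_sum)
      show "finite (PiE UNIV B)" by (intro finite_PiE) (auto simp: B_def)
      show "{\<omega> \<in> space M. R \<omega> = (\<chi> i. f i) \<and> xi Q (A \<omega>) = x} \<in> events" for f
        by (rule ev[of "\<lambda>a r. r = (\<chi> i. f i) \<and> xi Q a = x"])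
      show "{\<omega> \<in> space M. E \<omega> \<and> xi Q (A \<omega>) = x} \<in> events"
        unfolding E_def by (rule ev[of "\<lambda>a r. (\<forall>i\<in>I. r $ i = 1) \<and> xi Q a = x"])
      show "\<exists>!f\<in>PiE UNIV B. R \<omega> = (\<chi> i. f i)" if "\<omega> \<in> space M" "E \<omega>" for \<omega>
      proof (rule ex1I[of _ "\<lambda>i. R \<omega> $ i"])
        show "(\<lambda>i. R \<omega> $ i) \<in> PiE UNIV B \<and> R \<omega> = (\<chi> i. R \<omega> $ i)"
          using R01[OF that(1)] that(2) by (auto simp: B_def E_def)
      qed (auto simp: vec_eq_iff)
      show "E \<omega>" if "f \<in> PiE UNIV B" "R \<omega> = (\<chi> i. f i)" for \<omega> f
        unfolding E_def
      proof
        fix i assume "i \<in> I"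
        with PiE_mem[OF that(1), of i] that(2) show "R \<omega> $ i = 1" by (simp add: B_def)
      qed
    qed
    also have "\<dots> = (\<Sum>f\<in>PiE UNIV B. \<Prod>i\<in>UNIV. \<P>(\<omega> in M. R \<omega> $ i = f i \<bar> xi Q (A \<omega>) = x))"
      by (simp add: indep[OF pos])
    also have "\<dots> = (\<Prod>i\<in>UNIV. \<Sum>b\<in>B i. \<P>(\<omega> in M. R \<omega> $ i = b \<bar> xi Q (A \<omega>) = x))"
      by (rule prod_sum_PiE[symmetric]) (auto simp: B_def)
    also have "\<dots> = (\<Prod>i\<in>UNIV. if i \<in> I then (c $ i) ^ (x $ i) * (g $ i) ^ (1 - x $ i) else 1)"
      by (simp only: marginal)
    also have "\<dots> = (\<Prod>i\<in>I. (c $ i) ^ (x $ i) * (g $ i) ^ (1 - x $ i))"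
      by (simp add: prod.If_cases)
    finally show ?thesis .
  qed
  have joint: "\<P>(\<omega> in M. E \<omega> \<and> xi Q (A \<omega>) = x) =
      (\<Sum>a\<in>{a \<in> binary_vectors. xi Q a = x}. T_matrix c g Q I a * p a)" for x
  proof -
    have mass: "\<P>(\<omega> in M. xi Q (A \<omega>) = x) = (\<Sum>a\<in>{a \<in> binary_vectors. xi Q a = x}. p a)"
    proof -
      have "\<P>(\<omega> in M. xi Q (A \<omega>) = x) = (\<Sum>a\<in>{a \<in> binary_vectors. xi Q a = x}. \<P>(\<omega> in M. A \<omega> = a))"
      proof (rule prob_sum)
        show "finite {a \<in> binary_vectors. xi Q a = x}" by (simp add: finite_binary_vectors)
        show "{\<omega> \<in> space M. A \<omega> = a} \<in> events" for a by (rule ev[of "\<lambda>b r. b = a"])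
        show "{\<omega> \<in> space M. xi Q (A \<omega>) = x} \<in> events" by (rule ev[of "\<lambda>b r. xi Q b = x"])
      qed (use bin in \<open>auto intro!: AE_I2\<close>)
      then show ?thesis by (simp add: law)
    qed
    have T: "T_matrix c g Q I a = (\<Prod>i\<in>I. (c $ i) ^ (x $ i) * (g $ i) ^ (1 - x $ i))"
      if "a \<in> binary_vectors" "xi Q a = x" for a
    proof -
      have x01: "x $ i \<in> {0, 1}" for i
        using xi_in_binary_vectors[OF Q that(1)] that(2) by (auto simp: binary_vectors_def)
      have "g $ i + (c $ i - g $ i) * real (x $ i) = (c $ i) ^ (x $ i) * (g $ i) ^ (1 - x $ i)" for i
        using x01[of i] by auto
      then show ?thesis by (simp add: T_matrix_def that(2))
    qed
    have "\<P>(\<omega> in M. E \<omega> \<and> xi Q (A \<omega>) = x) =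
        (\<Prod>i\<in>I. (c $ i) ^ (x $ i) * (g $ i) ^ (1 - x $ i)) * \<P>(\<omega> in M. xi Q (A \<omega>) = x)"
    \<comment> \<open>The response model says nothing about ideal response vectors of probability zero, for which
      both sides vanish.\<close>
    proof (cases "\<P>(\<omega> in M. xi Q (A \<omega>) = x) > 0")
      case True
      then show ?thesis using cond[OF True] by (simp add: cond_prob_def field_simps)
    next
      case False
      then have 0: "\<P>(\<omega> in M. xi Q (A \<omega>) = x) = 0" by (simp add: zero_less_measure_iff)
      have "\<P>(\<omega> in M. E \<omega> \<and> xi Q (A \<omega>) = x) \<le> \<P>(\<omega> in M. xi Q (A \<omega>) = x)"
        by (rule finite_measure_mono) (auto intro: ev[of "\<lambda>b r. xi Q b = x"])
      with 0 show ?thesis by (simp add: measure_le_0_iff)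
    qed
    then show ?thesis by (simp add: mass T sum_distrib_left)
  qed
  have "\<P>(\<omega> in M. E \<omega>) = (\<Sum>x\<in>binary_vectors. \<P>(\<omega> in M. E \<omega> \<and> xi Q (A \<omega>) = x))"
  proof (rule prob_sum[OF finite_binary_vectors])
    show "{\<omega> \<in> space M. E \<omega> \<and> xi Q (A \<omega>) = x} \<in> events" for x
      unfolding E_def by (rule ev[of "\<lambda>a r. (\<forall>i\<in>I. r $ i = 1) \<and> xi Q a = x"])
    show "{\<omega> \<in> space M. E \<omega>} \<in> events"
      unfolding E_def by (rule ev[of "\<lambda>a r. \<forall>i\<in>I. r $ i = 1"])
  qed (use bin(1) xi_in_binary_vectors[OF Q] in \<open>auto intro!: AE_I2\<close>)
  also have "\<dots> = (\<Sum>a\<in>binary_vectors. T_matrix c g Q I a * p a)"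
    unfolding joint by (rule sum.group) (auto simp: finite_binary_vectors xi_in_binary_vectors[OF Q])
  finally show ?thesis by (simp add: E_def response_moment_eq_sum[OF Q])
qed

section \<open>Convergence of the empirical frequencies\<close>

text \<open>The weak law of large numbers for relative frequencies, with the rate of Hoeffding's inequality.\<close>

lemma (in prob_space) frequency_tendsto_in_probability:
  assumes indep: "indep_vars (\<lambda>_. count_space D) X {1::nat..}"
    and prob: "\<And>r. r \<ge> 1 \<Longrightarrow> \<P>(\<omega> in M. P (X r \<omega>)) = q" and \<delta>: "\<delta> > 0"
  shows "(\<lambda>N. \<P>(\<omega> in M. \<bar>real (card {r \<in> {1..N}. P (X r \<omega>)}) / real N - q\<bar> \<ge> \<delta>)) \<longlonglongrightarrow> 0"
proof (rule tendsto_sandwich[OF _ _ tendsto_const])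
  show "(\<lambda>N. 2 * exp (- (2 * \<delta>\<^sup>2) * real N)) \<longlonglongrightarrow> 0" using \<delta> by real_asymp
  show "\<forall>\<^sub>F N in sequentially.
      \<P>(\<omega> in M. \<bar>real (card {r \<in> {1..N}. P (X r \<omega>)}) / real N - q\<bar> \<ge> \<delta>)
        \<le> 2 * exp (- (2 * \<delta>\<^sup>2) * real N)"
    using eventually_gt_at_top[of 0]
  proof eventually_elim
    case (elim N)
    define Y where "Y r \<omega> = (of_bool (P (X r \<omega>)) :: real)" for r \<omega>
    have mean: "expectation (Y r) = q" if "r \<in> {1..N}" for r
    proof -
      have "Y r = indicator {\<omega>. P (X r \<omega>)}" by (auto simp: Y_def indicator_def)
      then have "expectation (Y r) = prob ({\<omega>. P (X r \<omega>)} \<inter> space M)" by simp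
      also have "{\<omega>. P (X r \<omega>)} \<inter> space M = {\<omega> \<in> space M. P (X r \<omega>)}" by auto
      finally show ?thesis using that prob by simp
    qed
    have "indep_vars (\<lambda>_. borel) Y {1..}"
      unfolding Y_def by (rule indep_vars_compose2[OF indep, where Y = "\<lambda>_ x. of_bool (P x)"]) simp
    then have "indep_vars (\<lambda>_. borel) Y {1..N}" by (rule indep_vars_subset) auto
    then interpret Hoeffding_ineq M "{1..N}" Y "\<lambda>_. 0" "\<lambda>_. 1" "real N * q"
      by unfold_locales (auto simp: Y_def mean)
    have "(\<Sum>r\<in>{1..N}. Y r \<omega>) = real (card {r \<in> {1..N}. P (X r \<omega>)})" for \<omega>
      by (simp add: Y_def Int_def conj_assoc)
    moreover have "\<bar>s / real N - q\<bar> \<ge> \<delta> \<longleftrightarrow> \<bar>s - real N * q\<bar> \<ge> real N * \<delta>" for s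
    proof -
      have "s / real N - q = (s - real N * q) / real N" using elim by (simp add: field_simps)
      then have "\<bar>s / real N - q\<bar> = \<bar>s - real N * q\<bar> / real N" by (simp only: abs_divide abs_of_nat)
      then show ?thesis using elim by (simp add: pos_le_divide_eq mult.commute)
    qed
    moreover have "- 2 * (real N * \<delta>)\<^sup>2 / (\<Sum>r\<in>{1..N}. (1 - 0)\<^sup>2) = - (2 * \<delta>\<^sup>2) * real N"
      using elim by (simp add: power2_eq_square field_simps)
    ultimately show ?case
      using Hoeffding_ineq_abs_ge[of "real N * \<delta>"] elim \<delta> by simp
  qed
qed auto

text \<open>
  An event that can only fail when one of finitely many asymptotically negligible events occurs has
  asymptotic probability 1.
\<close>

lemma (in prob_space) prob_tendsto_1_if_exceptions_negligible:
  assumes fin: "finite J"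
    and meas: "\<And>N j. N \<ge> 1 \<Longrightarrow> j \<in> J \<Longrightarrow> {\<omega> \<in> space M. B N j \<omega>} \<in> events"
    and tendsto: "\<And>j. j \<in> J \<Longrightarrow> (\<lambda>N::nat. \<P>(\<omega> in M. B N j \<omega>)) \<longlonglongrightarrow> 0"
    and E: "\<And>N. N \<ge> 1 \<Longrightarrow> {\<omega> \<in> space M. E N \<omega>} \<in> events"
    and imp: "\<And>N \<omega>. N \<ge> 1 \<Longrightarrow> \<omega> \<in> space M \<Longrightarrow> (\<And>j. j \<in> J \<Longrightarrow> \<not> B N j \<omega>) \<Longrightarrow> E N \<omega>"
  shows "(\<lambda>N. \<P>(\<omega> in M. E N \<omega>)) \<longlonglongrightarrow> 1"
proof (rule tendsto_sandwich[OF _ _ _ tendsto_const])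
  have "(\<lambda>N. \<Sum>j\<in>J. \<P>(\<omega> in M. B N j \<omega>)) \<longlonglongrightarrow> (\<Sum>j\<in>J. 0)"
    by (intro tendsto_sum tendsto)
  then show "(\<lambda>N. 1 - (\<Sum>j\<in>J. \<P>(\<omega> in M. B N j \<omega>))) \<longlonglongrightarrow> 1"
    using tendsto_diff[OF tendsto_const, of _ "0 :: real" _ "1 :: real"] by simp
  show "\<forall>\<^sub>F N in sequentially. 1 - (\<Sum>j\<in>J. \<P>(\<omega> in M. B N j \<omega>)) \<le> \<P>(\<omega> in M. E N \<omega>)"
    using eventually_ge_at_top[of 1]
  proof eventually_elim
    case (elim N)
    have "1 = prob (space M)" by (simp add: prob_space)
    also have "\<dots> \<le> prob ({\<omega> \<in> space M. E N \<omega>} \<union> (\<Union>j\<in>J. {\<omega> \<in> space M. B N j \<omega>}))"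
      using imp[OF elim] fin meas[OF elim] E[OF elim] by (intro finite_measure_mono) blast+
    also have "\<dots> \<le> \<P>(\<omega> in M. E N \<omega>) + prob (\<Union>j\<in>J. {\<omega> \<in> space M. B N j \<omega>})"
      using fin meas[OF elim] E[OF elim] by (intro measure_Un_le) blast+
    also have "prob (\<Union>j\<in>J. {\<omega> \<in> space M. B N j \<omega>}) \<le> (\<Sum>j\<in>J. \<P>(\<omega> in M. B N j \<omega>))"
      using fin meas[OF elim] by (intro measure_UNION_le) blast+
    finally show ?case by simp
  qed
qed auto

section \<open>Consistency\<close>

theorem theorem3p1:
  fixes M :: "'w measure"
    and Q :: "nat ^ 'k::finite ^ 'm::finite"
    and c g :: "real ^ 'm"
    and rws :: "'m set set"
    and A :: "nat \<Rightarrow> 'w \<Rightarrow> nat ^ 'k"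
    and R :: "nat \<Rightarrow> 'w \<Rightarrow> nat ^ 'm"
    and pstar :: "nat ^ 'k \<Rightarrow> real"
    and Qhat :: "nat \<Rightarrow> 'w \<Rightarrow> nat ^ 'k ^ 'm"
  assumes M: "prob_space M"
    and Q: "Q_matrix Q"
    and cg: "\<And>i. c $ i \<in> {0..1}" "\<And>i. g $ i \<in> {0..1}"
    and C1: "complete_Q Q"
    and C2: "saturated rws"
    and C3_indep: "prob_space.indep_vars M (\<lambda>_. count_space binary_vectors) A {1..}"
    and C3_dist: "\<And>r a. r \<ge> 1 \<Longrightarrow> a \<in> binary_vectors \<Longrightarrow> \<P>(\<omega> in M. A r \<omega> = a) = pstar a"
    and C4: "\<And>a. a \<in> binary_vectors \<Longrightarrow> pstar a > 0"
    and C5: "\<And>j. card {i. Q $ i $ j = 1} \<ge> 2"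
    and subjects_indep:
      "prob_space.indep_vars M (\<lambda>_. count_space (binary_vectors \<times> binary_vectors))
         (\<lambda>r \<omega>. (A r \<omega>, R r \<omega>)) {1..}"
    and responses_indep:
      "\<And>r x y. r \<ge> 1 \<Longrightarrow> \<P>(\<omega> in M. xi Q (A r \<omega>) = x) > 0 \<Longrightarrow>
         \<P>(\<omega> in M. R r \<omega> = y \<bar> xi Q (A r \<omega>) = x) =
           (\<Prod>i\<in>UNIV. \<P>(\<omega> in M. R r \<omega> $ i = y $ i \<bar> xi Q (A r \<omega>) = x))"
    and responses_dist:
      "\<And>r x i. r \<ge> 1 \<Longrightarrow> \<P>(\<omega> in M. xi Q (A r \<omega>) = x) > 0 \<Longrightarrow>
         \<P>(\<omega> in M. R r \<omega> $ i = 1 \<bar> xi Q (A r \<omega>) = x) = (c $ i) ^ (x $ i) * (g $ i) ^ (1 - x $ i)"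
    and Qhat_measurable: "\<And>N. N \<ge> 1 \<Longrightarrow> Qhat N \<in> M \<rightarrow>\<^sub>M count_space UNIV"
    and Qhat_arginf:
      "\<And>N \<omega>. N \<ge> 1 \<Longrightarrow> \<omega> \<in> space M \<Longrightarrow>
         is_arg_min (S_fun rws c g (alpha_vec (\<lambda>r. R r \<omega>) N)) Q_matrix (Qhat N \<omega>)"
    and c_neq_g: "\<And>i. c $ i \<noteq> g $ i"
    and nonzero: "\<And>I. I \<in> rws \<Longrightarrow> mult_T (T_matrix0 (c - g) Q) pstar I \<noteq> 0"
  shows "((\<lambda>N. \<P>(\<omega> in M. Qhat N \<omega> \<sim>\<^sub>Q Q)) \<longlonglongrightarrow> 1) \<and>
    (\<forall>(Qbar :: nat \<Rightarrow> 'w \<Rightarrow> nat ^ 'k ^ 'm) (ptilde :: nat \<Rightarrow> 'w \<Rightarrow> nat ^ 'k \<Rightarrow> real).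
       (\<forall>N\<ge>1. \<forall>\<omega>\<in>space M. Qbar N \<omega> \<sim>\<^sub>Q Qhat N \<omega> \<and>
          (Qhat N \<omega> \<sim>\<^sub>Q Q \<longrightarrow> Qbar N \<omega> = Q)) \<longrightarrow>
       (\<forall>N\<ge>1. \<forall>a\<in>binary_vectors. (\<lambda>\<omega>. ptilde N \<omega> a) \<in> borel_measurable M) \<longrightarrow>
       (\<forall>N\<ge>1. \<forall>\<omega>\<in>space M.
          is_arg_min (\<lambda>p. (residual rws c g (alpha_vec (\<lambda>r. R r \<omega>) N) (Qbar N \<omega>) p)\<^sup>2)
            (\<lambda>p. p \<in> prob_vectors) (ptilde N \<omega>)) \<longrightarrow>
       (\<forall>\<epsilon>>0. (\<lambda>N. \<P>(\<omega> in M.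
          L2_set (\<lambda>a. ptilde N \<omega> a - pstar a) (binary_vectors - {0}) \<le> \<epsilon>)) \<longlonglongrightarrow> 1))"
proof -
  interpret prob_space M by (rule M)
  have rv: "(\<lambda>\<omega>. (A r \<omega>, R r \<omega>)) \<in> M \<rightarrow>\<^sub>M count_space (binary_vectors \<times> binary_vectors)"
    if "r \<ge> 1" for r
    using subjects_indep that by (auto simp: indep_vars_def)
  have ev: "{\<omega> \<in> space M. P (A r \<omega>, R r \<omega>)} \<in> events" if "r \<ge> 1" for P r
  proof -
    have "(\<lambda>\<omega>. (A r \<omega>, R r \<omega>)) -` {z \<in> binary_vectors \<times> binary_vectors. P z} \<inter> space M \<in> events"
      by (rule measurable_sets[OF rv[OF that]]) auto
    also have "(\<lambda>\<omega>. (A r \<omega>, R r \<omega>)) -` {z \<in> binary_vectors \<times> binary_vectors. P z} \<inter> space M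
        = {\<omega> \<in> space M. P (A r \<omega>, R r \<omega>)}"
      using measurable_space[OF rv[OF that]] by auto
    finally show ?thesis .
  qed
  have pstar: "pstar \<in> prob_vectors"
  proof -
    have "\<P>(\<omega> in M. True) = (\<Sum>a\<in>binary_vectors. \<P>(\<omega> in M. A 1 \<omega> = a))"
    proof (rule prob_sum[OF finite_binary_vectors])
      show "{\<omega> \<in> space M. A 1 \<omega> = a} \<in> events" for a
        using ev[of 1 "\<lambda>z. fst z = a"] by simp
      show "AE \<omega> in M. (\<forall>a\<in>binary_vectors. A 1 \<omega> = a \<longrightarrow> True) \<and>
          (True \<longrightarrow> (\<exists>!a\<in>binary_vectors. A 1 \<omega> = a))"
        using measurable_space[OF rv[of 1]] by (intro AE_I2) auto
    qed auto
    then have "(\<Sum>a\<in>binary_vectors. pstar a) = 1" by (simp add: C3_dist prob_space)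
    moreover have "pstar a \<in> {0..1}" if "a \<in> binary_vectors" for a
      using C3_dist[of 1 a] that prob_le_1[of "{\<omega> \<in> space M. A 1 \<omega> = a}"] measure_nonneg
      by (metis atLeastAtMost_iff order_refl)
    ultimately show ?thesis by (simp add: prob_vectors_def)
  qed
  \<comment> \<open>The exceptional event: the empirical frequency for \<open>I\<close> misses its expectation by at least \<open>\<delta>\<close>.\<close>
  define far where "far \<delta> N I \<omega> \<longleftrightarrow>
      \<bar>alpha_vec (\<lambda>r. R r \<omega>) N I - response_moment c g Q pstar I\<bar> \<ge> \<delta>" for \<delta> N I \<omega>
  have far_event: "{\<omega> \<in> space M. far \<delta> N I \<omega>} \<in> events" for \<delta> N I
  proof -
    have eq: "(\<lambda>\<omega>. alpha_vec (\<lambda>r. R r \<omega>) N I) =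
        (\<lambda>\<omega>. (\<Sum>r\<in>{1..N}. of_bool (\<forall>i\<in>I. R r \<omega> $ i = 1)) / real N)"
      by (simp add: alpha_vec_def fun_eq_iff Int_def conj_assoc)
    have "(\<lambda>\<omega>. of_bool (\<forall>i\<in>I. R r \<omega> $ i = 1) :: real) \<in> borel_measurable M" if "r \<in> {1..N}" for r
      using measurable_compose[OF rv[of r], of "\<lambda>z. of_bool (\<forall>i\<in>I. snd z $ i = 1) :: real" borel] that
      by simp
    then have [measurable]: "(\<lambda>\<omega>. alpha_vec (\<lambda>r. R r \<omega>) N I) \<in> borel_measurable M"
      unfolding eq by (intro borel_measurable_divide borel_measurable_sum borel_measurable_const)
    show ?thesis unfolding far_def by measurable
  qed
  have far_tendsto: "(\<lambda>N. \<P>(\<omega> in M. far \<delta> N I \<omega>)) \<longlonglongrightarrow> 0" if "\<delta> > 0" for \<delta> I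
  proof -
    have "\<P>(\<omega> in M. \<forall>i\<in>I. snd (A r \<omega>, R r \<omega>) $ i = 1) = response_moment c g Q pstar I"
      if "r \<ge> 1" for r
      using prob_positive_responses[OF Q rv[OF that] C3_dist[OF that] responses_indep[OF that]
          responses_dist[OF that]] by simp
    from frequency_tendsto_in_probability[where P = "\<lambda>z. \<forall>i\<in>I. snd z $ i = 1",
        OF subjects_indep this \<open>\<delta> > 0\<close>]
    show ?thesis by (simp add: far_def alpha_vec_def)
  qed
  have Qhat_event: "{\<omega> \<in> space M. Qhat N \<omega> \<sim>\<^sub>Q Q} \<in> events" if "N \<ge> 1" for N
    using measurable_sets_Collect[OF Qhat_measurable[OF that], of "\<lambda>Q'. Q' \<sim>\<^sub>Q Q"] by simp
  show ?thesis
  proof (intro conjI allI impI)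
    obtain \<delta> where \<delta>: "\<delta> > 0"
      "\<And>\<alpha> Q'. \<lbrakk>\<And>I. I \<noteq> {} \<Longrightarrow> \<bar>\<alpha> I - response_moment c g Q pstar I\<bar> < \<delta>;
        is_arg_min (S_fun rws c g \<alpha>) Q_matrix Q'\<rbrakk> \<Longrightarrow> Q' \<sim>\<^sub>Q Q"
      using minimizers_stable[OF Q C1 C2 c_neq_g pstar C4 zero_less_one] by metis
    show "(\<lambda>N. \<P>(\<omega> in M. Qhat N \<omega> \<sim>\<^sub>Q Q)) \<longlonglongrightarrow> 1"
    proof (rule prob_tendsto_1_if_exceptions_negligible[of UNIV "far \<delta>"])
      fix N \<omega> assume N: "N \<ge> 1" "\<omega> \<in> space M" and "\<And>I. I \<in> UNIV \<Longrightarrow> \<not> far \<delta> N I \<omega>"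
      then show "Qhat N \<omega> \<sim>\<^sub>Q Q"
        by (intro \<delta>(2)[OF _ Qhat_arginf[OF N]]) (simp add: far_def not_le)
    qed (use far_event far_tendsto[OF \<delta>(1)] Qhat_event in auto)
  next
    fix Qbar :: "nat \<Rightarrow> 'w \<Rightarrow> nat ^ 'k ^ 'm" and ptilde :: "nat \<Rightarrow> 'w \<Rightarrow> nat ^ 'k \<Rightarrow> real"
      and \<epsilon> :: real
    assume Qbar: "\<forall>N\<ge>1. \<forall>\<omega>\<in>space M. Qbar N \<omega> \<sim>\<^sub>Q Qhat N \<omega> \<and> (Qhat N \<omega> \<sim>\<^sub>Q Q \<longrightarrow> Qbar N \<omega> = Q)"
      and meas: "\<forall>N\<ge>1. \<forall>a\<in>binary_vectors. (\<lambda>\<omega>. ptilde N \<omega> a) \<in> borel_measurable M"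
      and min: "\<forall>N\<ge>1. \<forall>\<omega>\<in>space M.
          is_arg_min (\<lambda>p. (residual rws c g (alpha_vec (\<lambda>r. R r \<omega>) N) (Qbar N \<omega>) p)\<^sup>2)
            (\<lambda>p. p \<in> prob_vectors) (ptilde N \<omega>)"
      and \<epsilon>: "\<epsilon> > 0"
    \<comment> \<open>The Euclidean distance is at most the sum of the coordinate distances, so \<open>\<epsilon> / n\<close> per
      coordinate suffices; the added 1 keeps \<open>n\<close> positive without a cardinality argument.\<close>
    define n where "n = real (card (binary_vectors :: (nat ^ 'k) set)) + 1"
    have n: "n > 0" by (simp add: n_def add_nonneg_pos)
    then have "\<epsilon> / n > 0" using \<epsilon> by simp
    from minimizers_stable[OF Q C1 C2 c_neq_g pstar C4 this]
    obtain \<delta> where \<delta>: "\<delta> > 0"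
      "\<And>\<alpha> Q'. \<lbrakk>\<And>I. I \<noteq> {} \<Longrightarrow> \<bar>\<alpha> I - response_moment c g Q pstar I\<bar> < \<delta>;
        is_arg_min (S_fun rws c g \<alpha>) Q_matrix Q'\<rbrakk> \<Longrightarrow> Q' \<sim>\<^sub>Q Q"
      "\<And>\<alpha> p a. \<lbrakk>\<And>I. I \<noteq> {} \<Longrightarrow> \<bar>\<alpha> I - response_moment c g Q pstar I\<bar> < \<delta>;
        is_arg_min (\<lambda>p. (residual rws c g \<alpha> Q p)\<^sup>2) (\<lambda>p. p \<in> prob_vectors) p;
        a \<in> binary_vectors\<rbrakk> \<Longrightarrow> \<bar>p a - pstar a\<bar> \<le> \<epsilon> / n"
      by metis
    show "(\<lambda>N. \<P>(\<omega> in M. L2_set (\<lambda>a. ptilde N \<omega> a - pstar a) (binary_vectors - {0}) \<le> \<epsilon>)) \<longlonglongrightarrow> 1"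
    proof (rule prob_tendsto_1_if_exceptions_negligible[of UNIV "far \<delta>"])
      fix N \<omega> assume N: "N \<ge> 1" "\<omega> \<in> space M" and "\<And>I. I \<in> UNIV \<Longrightarrow> \<not> far \<delta> N I \<omega>"
      then have close: "\<bar>alpha_vec (\<lambda>r. R r \<omega>) N I - response_moment c g Q pstar I\<bar> < \<delta>" for I
        by (simp add: far_def not_le)
      have "Qhat N \<omega> \<sim>\<^sub>Q Q" by (rule \<delta>(2)[OF close Qhat_arginf[OF N]])
      with Qbar N have "Qbar N \<omega> = Q" by blast
      with min N have arg: "is_arg_min (\<lambda>p. (residual rws c g (alpha_vec (\<lambda>r. R r \<omega>) N) Q p)\<^sup>2)
          (\<lambda>p. p \<in> prob_vectors) (ptilde N \<omega>)" by metis
      have "L2_set (\<lambda>a. ptilde N \<omega> a - pstar a) (binary_vectors - {0}) \<le>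
          (\<Sum>a\<in>binary_vectors - {0}. \<bar>ptilde N \<omega> a - pstar a\<bar>)"
        by (rule L2_set_le_sum_abs)
      also have "\<dots> \<le> (\<Sum>a\<in>binary_vectors. \<bar>ptilde N \<omega> a - pstar a\<bar>)"
        by (intro sum_mono2) (auto simp: finite_binary_vectors)
      also have "\<dots> \<le> (\<Sum>a\<in>(binary_vectors :: (nat ^ 'k) set). \<epsilon> / n)"
        by (intro sum_mono \<delta>(3)[OF close arg])
      also have "\<dots> = (n - 1) * (\<epsilon> / n)" by (simp add: n_def)
      also have "\<dots> \<le> n * (\<epsilon> / n)"
        using \<open>\<epsilon> / n > 0\<close> by (intro mult_right_mono) auto
      also have "\<dots> = \<epsilon>" using n by simp
      finally show "L2_set (\<lambda>a. ptilde N \<omega> a - pstar a) (binary_vectors - {0}) \<le> \<epsilon>" .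
    next
      fix N :: nat assume N: "N \<ge> 1"
      have "(\<lambda>\<omega>. L2_set (\<lambda>a. ptilde N \<omega> a - pstar a) (binary_vectors - {0})) \<in> borel_measurable M"
        unfolding L2_set_def using meas N
        by (intro measurable_compose[OF _ borel_measurable_sqrt] borel_measurable_sum borel_measurable_power borel_measurable_diff) auto
      then show "{\<omega> \<in> space M. L2_set (\<lambda>a. ptilde N \<omega> a - pstar a) (binary_vectors - {0}) \<le> \<epsilon>} \<in> events"
        by measurable
    qed (use far_event far_tendsto[OF \<delta>(1)] in auto)
  qed
qed

end
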